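(* Let $k>0$, $c>0$, $\nu>0$. (a) The radius of convexity $r^{c}({}_{k}g_{\nu,c})$ of the function $$z\mapsto{}_{k}g_{\nu,c}(z)=2^{\frac{\nu}{k}}\Gamma_{k}(\nu+k)z^{1-\frac{\nu}{k}}{}_{k}W_{\nu,c}(z)$$ is the smallest positive root of the equation $\left(z\,{}_{k}g_{\nu,c}'(z)\right)'=0$ and satisfies the inequality $$\frac{2}{3}\sqrt{\frac{\nu+k}{c}}<r^{c}({}_{k}g_{\nu,c})<6\sqrt{\frac{(\nu+k)(\nu+2k)}{c(56\nu+137k)}}.$$ (b) The radius of convexity $r^{c}({}_{k}h_{\nu,c})$ of the function $$z\mapsto{}_{k}h_{\nu,c}(z)=2^{\frac{\nu}{k}}\Gamma_{k}(\nu+k)z^{1-\frac{\nu}{2k}}{}_{k}W_{\nu,c}(\sqrt{z})$$ is the smallest positive root of the equation $\left(z\,{}_{k}h_{\nu,c}'(z)\right)'=0$ and satisfies the inequality $$\frac{\nu+k}{c}<r^{c}({}_{k}h_{\nu,c})<\frac{16(\nu+k)(\nu+2k)}{c(7\nu+23k)}.$$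
   Context: For $k>0$ the $k$-gamma function is $\Gamma_{k}(z)=\int_{0}^{\infty}t^{z-1}e^{-t^{k}/k}\,dt$ for $\operatorname{Re}(z)>0$; equivalently $\Gamma_k(z)=k^{\frac{z}{k}-1}\Gamma\left(\frac{z}{k}\right)$. The generalized $k$-Bessel function of order $\nu$ is $${}_{k}W_{\nu,c}(z)=\sum_{n=0}^{\infty}\frac{(-c)^n}{n!\,\Gamma_{k}(nk+\nu+k)}\left(\frac{z}{2}\right)^{2n+\frac{\nu}{k}}.$$ Multivalued functions are taken with the principal branch; the functions ${}_{k}g_{\nu,c}$ and ${}_{k}h_{\nu,c}$ are then entire: with $w(z)=\Gamma_k(\nu+k)\sum_{n\ge0}\frac{(-c)^n}{n!\,\Gamma_k(nk+\nu+k)}\left(\frac{z}{2}\right)^{2n}$ one has ${}_{k}g_{\nu,c}(z)=z\,w(z)$ and ${}_{k}h_{\nu,c}(z)=z\,w(\sqrt z)$, and both have value $0$ and derivative $1$ at $0$. Let $\mathbb{D}_r=\{z\in\mathbb{C}:|z|<r\}$. For $f$ analytic near $0$ with $f(0)=f'(0)-1=0$, the radius of convexity (of order zero) is $$r^{c}(f)=\sup\left\{r>0:\ \operatorname{Re}\left(1+\frac{zf''(z)}{f'(z)}\right)>0\ \text{for all } z\in\mathbb{D}_r\right\},$$ where $r$ ranges over values not exceeding the radius of convergence of the Taylor series of $f$ at $0$. *)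

theory Defs
  imports "HOL-Complex_Analysis.Complex_Analysis"
begin

(* Meaningful for k > 0 and Re z > 0, where the integral converges absolutely. *)
definition k_gamma :: "real \<Rightarrow> complex \<Rightarrow> complex" where
  "k_gamma k z =
     integral {0..} (\<lambda>t::real. of_real t powr (z - 1) * of_real (exp (- (t powr k) / k)))"

definition k_Bessel :: "real \<Rightarrow> real \<Rightarrow> real \<Rightarrow> complex \<Rightarrow> complex" where
  "k_Bessel k \<nu> c z =
     (\<Sum>n. of_real ((- c) ^ n) / (fact n * k_gamma k (of_real (real n * k + \<nu> + k)))
           * (z / 2) powr of_real (2 * real n + \<nu> / k))"

(* The powers of z are principal, and Ln (z / 2) = Ln z - ln 2 and Ln (csqrt z) = Ln z / 2
   for z \<noteq> 0.  So the fractional powers cancel on the branch cut too, and as 0 powr a = 0,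
   the two functions below are entire as they stand, with value 0 at 0. *)

definition k_Bessel_g :: "real \<Rightarrow> real \<Rightarrow> real \<Rightarrow> complex \<Rightarrow> complex" where
  "k_Bessel_g k \<nu> c z =
     of_real (2 powr (\<nu> / k)) * k_gamma k (of_real (\<nu> + k))
       * z powr of_real (1 - \<nu> / k) * k_Bessel k \<nu> c z"

definition k_Bessel_h :: "real \<Rightarrow> real \<Rightarrow> real \<Rightarrow> complex \<Rightarrow> complex" where
  "k_Bessel_h k \<nu> c z =
     of_real (2 powr (\<nu> / k)) * k_gamma k (of_real (\<nu> + k))
       * z powr of_real (1 - \<nu> / (2 * k)) * k_Bessel k \<nu> c (csqrt z)"

(* The condition deriv f z \<noteq> 0 says that the quotient is defined; it has to be explicit because
   w / 0 = 0.  The supremum is taken in ereal, where an unbounded set has supremum \<infinity>. *)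
definition radius_of_convexity :: "(complex \<Rightarrow> complex) \<Rightarrow> ereal" where
  "radius_of_convexity f =
     Sup (ereal ` {r. 0 < r \<and> ereal r \<le> fps_conv_radius (fps_expansion f 0) \<and>
            (\<forall>z \<in> ball 0 r. deriv f z \<noteq> 0 \<and> Re (1 + z * deriv (deriv f) z / deriv f z) > 0)})"

definition smallest_positive_root :: "(complex \<Rightarrow> complex) \<Rightarrow> real \<Rightarrow> bool" where
  "smallest_positive_root F \<rho> \<longleftrightarrow>
     0 < \<rho> \<and> F (of_real \<rho>) = 0 \<and> (\<forall>x. 0 < x \<and> x < \<rho> \<longrightarrow> F (of_real x) \<noteq> 0)"

end

theory Submission
  imports Defs
begin

text \<open>
  Put \<open>m = \<nu>/k + 1\<close> and \<open>a = c/(4k)\<close>. The recurrence of the \<open>k\<close>-gamma function cancels all fractional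
  powers, so both functions have the form \<open>f(z) = z \<phi>(a z^p)\<close> with the entire function
  \<open>\<phi>(x) = \<Sum>n. (-x)^n / (n! (m)_n)\<close>, where \<open>p = 2\<close> for \<open>g\<close> and \<open>p = 1\<close> for \<open>h\<close>. The operator
  \<open>B \<mapsto> B + p x B'\<close> multiplies the \<open>n\<close>-th coefficient by \<open>pn + 1\<close>; it takes \<open>\<phi>\<close> to a series \<open>F\<close> and
  \<open>F\<close> to a series \<open>H\<close> such that \<open>f'(z) = F(a z^p)\<close> and \<open>(z f'(z))' = H(a z^p)\<close>. Hence
  \<open>1 + z f''/f' = H(x)/F(x) = 1 + p x F'(x)/F(x)\<close> with \<open>x = a z^p\<close>, and everything is a question about
  the first positive zero \<open>\<xi>\<close> of \<open>H\<close>.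

  The classical argument expands \<open>F'/F\<close> over the zeros of \<open>F\<close>, which are all real and positive. The only
  consequence of this that matters is that \<open>-F'/F\<close> has nonnegative Taylor coefficients, and that can be
  had without knowing the zeros. For \<open>V = -\<phi>'/\<phi>\<close> the Bessel equation becomes the Riccati equation
  \<open>x V' + m V = 1 + x V^2\<close>, which determines the coefficients of \<open>V\<close> (the Rayleigh sums) by a recursion
  with positive terms. Since \<open>F = \<phi> (1 - p x V)\<close>, and \<open>1/(1 - U)\<close> has nonnegative coefficients when \<open>U\<close>
  has them and vanishes at \<open>0\<close>, the series \<open>-F'/F\<close> and \<open>1/F\<close> inherit nonnegativity
  (\<open>nonneg_fps_Riccati\<close>, \<open>nonneg_fps_log_deriv_Dini\<close>).

  Nonnegative coefficients of \<open>1/F\<close> give \<open>|F(z)| \<ge> |F(|z|)|\<close> on every disc without zeros, so a zero of least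
  modulus forces a zero on the positive axis (\<open>nonzero_on_cball_of_nonneg_inverse\<close>). Up to \<open>\<xi>\<close> the
  function \<open>t F(t^p)\<close> has the positive derivative \<open>H(t^p)\<close>, so \<open>F > 0\<close> on \<open>[0, \<xi>]\<close>, and \<open>F\<close> has no
  zeros in the open disc of radius \<open>\<xi>\<close>. There \<open>|F'/F (x)| \<le> -F'/F (|x|)\<close>, and therefore
  \<open>Re (H/F)(x) \<ge> (H/F)(|x|) > 0\<close>. At \<open>x = \<xi>\<close> the quotient vanishes. So the radius of convexity is exactly
  the \<open>\<rho>\<close> with \<open>a \<rho>^p = \<xi>\<close> (\<open>radius_of_convexity_Bessel\<close>).

  The bounds are those of Euler and Rayleigh, \<open>1/\<sigma>\<^sub>1 < \<xi> < \<sigma>\<^sub>1/\<sigma>\<^sub>2\<close> for the power sums \<open>\<sigma>\<^sub>1, \<sigma>\<^sub>2\<close> of the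
  reciprocal zeros of \<open>H\<close>. Here they are verified directly: \<open>H\<close> is an alternating series, and Leibniz'
  criterion determines its sign up to the lower bound and at the upper bound. In both cases this needs only the
  first few terms.
\<close>

section \<open>Power series with nonnegative coefficients\<close>

definition nonneg_fps :: "complex fps \<Rightarrow> bool" where
  "nonneg_fps A \<longleftrightarrow> (\<forall>n. fps_nth A n \<in> \<real>\<^sub>\<ge>\<^sub>0)"

lemma sum_in_nonneg_Reals:
  "(\<And>i. i \<in> I \<Longrightarrow> a i \<in> \<real>\<^sub>\<ge>\<^sub>0) \<Longrightarrow> sum a I \<in> (\<real>\<^sub>\<ge>\<^sub>0 :: complex set)"
  by (induction I rule: infinite_finite_induct) auto

lemma nonneg_fps_add: "nonneg_fps A \<Longrightarrow> nonneg_fps B \<Longrightarrow> nonneg_fps (A + B)"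
  by (simp add: nonneg_fps_def)

lemma nonneg_fps_mult: "nonneg_fps A \<Longrightarrow> nonneg_fps B \<Longrightarrow> nonneg_fps (A * B)"
  by (auto simp: nonneg_fps_def fps_mult_nth intro!: sum_in_nonneg_Reals nonneg_Reals_mult_I)

lemma nonneg_fps_X: "nonneg_fps fps_X"
  by (simp add: nonneg_fps_def fps_X_def)

lemma nonneg_fps_const: "b \<in> \<real>\<^sub>\<ge>\<^sub>0 \<Longrightarrow> nonneg_fps (fps_const b)"
  by (simp add: nonneg_fps_def)

lemma nonneg_fps_deriv: "nonneg_fps A \<Longrightarrow> nonneg_fps (fps_deriv A)"
  unfolding nonneg_fps_def fps_deriv_nth by (metis nonneg_Reals_mult_I nonneg_Reals_of_nat_I)

text \<open>The geometric series, in the form of the recursion given by \<open>W = 1 + U W\<close>.\<close>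
lemma nonneg_fps_inverse_one_minus:
  assumes "nonneg_fps U" and "fps_nth U 0 = 0"
  shows "nonneg_fps (inverse (1 - U))"
proof -
  define W where "W = inverse (1 - U)"
  have "W * (1 - U) = 1"
    unfolding W_def using assms(2) by (intro inverse_mult_eq_1) auto
  hence W: "W = 1 + U * W" by (simp add: algebra_simps)
  have "fps_nth W n \<in> \<real>\<^sub>\<ge>\<^sub>0" for n
  proof (induction n rule: less_induct)
    case (less n)
    have "fps_nth W n = fps_nth (1 + U * W) n" using W by simp
    also have "\<dots> = fps_nth 1 n + (\<Sum>i=0..n. fps_nth U i * fps_nth W (n - i))"
      by (simp add: fps_mult_nth)
    also have "\<dots> \<in> \<real>\<^sub>\<ge>\<^sub>0"
    proof (intro nonneg_Reals_add_I sum_in_nonneg_Reals)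
      fix i assume "i \<in> {0..n}"
      show "fps_nth U i * fps_nth W (n - i) \<in> \<real>\<^sub>\<ge>\<^sub>0"
      proof (cases "i = 0")
        case False
        thus ?thesis using less[of "n - i"] \<open>i \<in> {0..n}\<close> assms(1)
          by (auto simp: nonneg_fps_def)
      qed (use assms in simp)
    qed simp
    finally show ?case .
  qed
  thus ?thesis by (simp add: nonneg_fps_def W_def)
qed

text \<open>\<open>Q = 1/P\<close> solves \<open>Q' = S Q\<close> with \<open>S = -P'/P\<close>, so it is the exponential of a nonnegative series.\<close>
lemma nonneg_fps_inverse_of_log_deriv:
  assumes "fps_nth P 0 = 1" and V: "nonneg_fps (- fps_deriv P * inverse P)"
  shows "nonneg_fps (inverse P)"
proof -
  define Q where "Q = inverse P"
  define S where "S = - fps_deriv P * inverse P"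
  have Q': "fps_deriv Q = S * Q"
    unfolding Q_def S_def using assms(1)
    by (simp add: fps_inverse_deriv power2_eq_square algebra_simps)
  have "fps_nth Q n \<in> \<real>\<^sub>\<ge>\<^sub>0" for n
  proof (induction n rule: less_induct)
    case (less n)
    show ?case
    proof (cases n)
      case 0
      thus ?thesis by (simp add: Q_def assms(1))
    next
      case (Suc m)
      have "of_nat (Suc m) * fps_nth Q (Suc m) = fps_nth (S * Q) m"
        using Q' fps_deriv_nth[of Q m] by simp
      hence "fps_nth Q (Suc m) = fps_nth (S * Q) m / of_nat (Suc m)"
        by (simp del: of_nat_Suc add: field_simps)
      also have "\<dots> \<in> \<real>\<^sub>\<ge>\<^sub>0"
        unfolding fps_mult_nth
        using V less Suc
        by (intro nonneg_Reals_divide_I nonneg_Reals_of_nat_I sum_in_nonneg_Reals nonneg_Reals_mult_I)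
           (auto simp: nonneg_fps_def S_def)
      finally show ?thesis using Suc by simp
    qed
  qed
  thus ?thesis by (simp add: nonneg_fps_def Q_def)
qed

text \<open>Comparing coefficients gives \<open>(n + m) v\<^sub>n = [n = 0] + (\<Sum>i + j = n - 1. v\<^sub>i v\<^sub>j)\<close>. For the Bessel series
  this is the recursion of the Rayleigh function.\<close>
lemma nonneg_fps_Riccati:
  fixes V :: "complex fps" and m :: real
  assumes "m > 0"
    and V: "fps_X * fps_deriv V + fps_const (of_real m) * V = 1 + fps_X * V\<^sup>2"
  shows "nonneg_fps V"
proof -
  have "fps_nth V n \<in> \<real>\<^sub>\<ge>\<^sub>0" for n
  proof (induction n rule: less_induct)
    case (less n)
    have "of_real (real n + m) * fps_nth V n
            = fps_nth (fps_X * fps_deriv V + fps_const (of_real m) * V) n"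
      by (cases n) (simp_all add: algebra_simps)
    also have "\<dots> = fps_nth 1 n + fps_nth (fps_X * V\<^sup>2) n"
      by (simp only: V fps_add_nth)
    also have "\<dots> \<in> \<real>\<^sub>\<ge>\<^sub>0"
    proof (intro nonneg_Reals_add_I)
      show "fps_nth (fps_X * V\<^sup>2) n \<in> \<real>\<^sub>\<ge>\<^sub>0"
        using less by (cases n)
          (auto simp: power2_eq_square fps_mult_nth[of V V] intro!: sum_in_nonneg_Reals nonneg_Reals_mult_I)
    qed simp
    finally have "of_real (real n + m) * fps_nth V n / of_real (real n + m) \<in> (\<real>\<^sub>\<ge>\<^sub>0 :: complex set)"
      using assms(1) by (intro nonneg_Reals_divide_I) (auto simp del: of_real_add)
    moreover have "complex_of_real (real n + m) \<noteq> 0"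
      using assms(1) by (simp del: of_real_add)
    ultimately show ?case by simp
  qed
  thus ?thesis by (simp add: nonneg_fps_def)
qed

text \<open>With \<open>V = -P'/P\<close> and \<open>U = b X V\<close> one has \<open>F = P (1 - U)\<close>, hence
  \<open>-F'/F = V + U'/(1 - U)\<close>, a sum of nonnegative series. A combination \<open>P + b X P'\<close> is the shape of the
  Dini functions in the theory of Bessel functions.\<close>
lemma nonneg_fps_log_deriv_Dini:
  fixes P :: "complex fps"
  assumes P0: "fps_nth P 0 = 1" and b: "b \<in> \<real>\<^sub>\<ge>\<^sub>0"
    and V: "nonneg_fps (- fps_deriv P * inverse P)"
  defines "F \<equiv> P + fps_const b * fps_X * fps_deriv P"
  shows "nonneg_fps (- fps_deriv F * inverse F)" "nonneg_fps (inverse F)"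
proof -
  define V' where "V' = - fps_deriv P * inverse P"
  define U where "U = fps_const b * fps_X * V'"
  have inv: "P * inverse P = 1" using P0 inverse_mult_eq_1[of P] by (simp add: mult.commute)
  have V'P: "fps_deriv P = - V' * P"
    unfolding V'_def using inv by (simp add: mult.assoc mult.commute[of "inverse P"])
  have F: "F = P * (1 - U)"
    unfolding F_def U_def V'P by (simp add: algebra_simps)
  have U: "nonneg_fps U" "fps_nth U 0 = 0"
    unfolding U_def V'_def
    by (intro nonneg_fps_mult nonneg_fps_const nonneg_fps_X b V) simp
  define W where "W = inverse (1 - U)"
  have W: "W * (1 - U) = 1"
    unfolding W_def using U(2) by (intro inverse_mult_eq_1) auto
  have invF: "inverse F = inverse P * W"
    unfolding F W_def by (rule fps_inverse_mult)
  have nW: "nonneg_fps W" unfolding W_def by (rule nonneg_fps_inverse_one_minus[OF U])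
  have F': "fps_deriv F = - V' * P * (1 - U) - P * fps_deriv U"
    unfolding F fps_deriv_mult V'P by (simp add: algebra_simps)
  have "- fps_deriv F * inverse F
           = V' * (P * inverse P) * (W * (1 - U)) + fps_deriv U * (P * inverse P) * W"
    unfolding invF F' by (simp add: algebra_simps)
  hence S: "- fps_deriv F * inverse F = V' + fps_deriv U * W"
    unfolding inv W by simp
  show *: "nonneg_fps (- fps_deriv F * inverse F)"
    unfolding S using V by (intro nonneg_fps_add nonneg_fps_mult nonneg_fps_deriv U nW) (simp add: V'_def)
  have "fps_nth F 0 = 1" unfolding F using P0 U(2) by simp
  from nonneg_fps_inverse_of_log_deriv[OF this *] show "nonneg_fps (inverse F)" .
qed

section \<open>Zeros and logarithmic derivatives of entire functions\<close>

text \<open>The triangle inequality for the Taylor series, which is an equality on the positive axis.\<close>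
lemma norm_le_of_nonneg_fps:
  assumes "f has_fps_expansion A" "nonneg_fps A" "f holomorphic_on ball 0 r" "norm z < r"
  shows "norm (f z) \<le> Re (f (of_real (norm z)))"
proof -
  have s: "(\<lambda>n. fps_nth A n * w ^ n) sums f w" if "norm w < r" for w
    using has_fps_expansion_imp_sums_complex[of f A "ereal r" w] assms(1,3) that by simp
  have "(\<lambda>n. Re (fps_nth A n * of_real (norm z) ^ n)) sums Re (f (of_real (norm z)))"
    using s[of "of_real (norm z)"] assms(4) by (intro sums_Re) simp
  moreover have "norm (fps_nth A n * z ^ n) \<le> Re (fps_nth A n * of_real (norm z) ^ n)" for n
  proof -
    have "fps_nth A n \<in> \<real>\<^sub>\<ge>\<^sub>0" using assms(2) by (simp add: nonneg_fps_def)
    then obtain x where x: "fps_nth A n = of_real x" "x \<ge> 0" by (rule nonneg_Reals_cases)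
    have "fps_nth A n * of_real (norm z) ^ n = of_real (x * norm z ^ n)" by (simp add: x)
    hence "Re (fps_nth A n * of_real (norm z) ^ n) = x * norm z ^ n" by (simp only: Re_complex_of_real)
    thus ?thesis using x by (simp add: norm_mult norm_power)
  qed
  ultimately show ?thesis
    using norm_sums_le[OF s[OF assms(4)]] by blast
qed

text \<open>A form of Pringsheim's theorem: when \<open>1/F\<close> has nonnegative coefficients, the singularity of \<open>1/F\<close> that is
  closest to \<open>0\<close> can be found on the positive axis. If \<open>z\<^sub>0\<close> is a zero of least modulus \<open>R\<close>, then
  \<open>|F(t R)| \<le> |F(t z\<^sub>0)|\<close> for \<open>0 < t < 1\<close>, and letting \<open>t\<close> tend to \<open>1\<close> yields \<open>F(R) = 0\<close>.\<close>
lemma nonzero_on_cball_of_nonneg_inverse: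
  assumes F: "F holomorphic_on UNIV" "F has_fps_expansion A"
    and A: "fps_nth A 0 \<noteq> 0" "nonneg_fps (inverse A)"
    and nz: "\<And>x. 0 \<le> x \<Longrightarrow> x \<le> r \<Longrightarrow> F (of_real x) \<noteq> 0"
    and z: "norm z \<le> r"
  shows "F z \<noteq> 0"
proof
  assume "F z = 0"
  have cont: "continuous_on X F" for X
    by (rule continuous_on_subset[OF holomorphic_on_imp_continuous_on[OF F(1)] subset_UNIV])
  define Z where "Z = cball 0 r \<inter> F -` {0}"
  have "compact Z"
  proof -
    have "closed (F -` {0})"
      using cont[of UNIV] by (intro closed_vimage) auto
    thus ?thesis unfolding Z_def by (intro compact_Int_closed) auto
  qed
  moreover have "Z \<noteq> {}" using \<open>F z = 0\<close> z by (auto simp: Z_def)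
  ultimately obtain z0 where z0: "z0 \<in> Z" "\<And>w. w \<in> Z \<Longrightarrow> norm z0 \<le> norm w"
    using continuous_attains_inf[of Z norm, OF _ _ continuous_on_norm_id] by auto
  define R where "R = norm z0"
  have "R \<le> r" "F z0 = 0" using z0(1) by (auto simp: Z_def R_def)
  have FR: "F (of_real R) \<noteq> 0" using \<open>R \<le> r\<close> by (intro nz) (auto simp: R_def)
  have nzR: "F w \<noteq> 0" if "w \<in> ball 0 R" for w
    using z0(2)[of w] that \<open>R \<le> r\<close> by (force simp: Z_def R_def)
  have hol: "(\<lambda>w. inverse (F w)) holomorphic_on ball 0 R"
    using nzR by (intro holomorphic_on_inverse holomorphic_on_subset[OF F(1) subset_UNIV]) auto
  have le: "norm (F (of_real (norm w))) \<le> norm (F w)" if "norm w < R" for w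
  proof -
    have "norm (inverse (F w)) \<le> Re (inverse (F (of_real (norm w))))"
      using has_fps_expansion_inverse[OF F(2) A(1)] A(2) hol that by (rule norm_le_of_nonneg_fps)
    also have "\<dots> \<le> norm (inverse (F (of_real (norm w))))" by (rule complex_Re_le_cmod)
    finally show ?thesis
      using nzR[of w] nzR[of "of_real (norm w)"] that by (simp add: norm_inverse)
  qed
  have "R > 0"
    using nz[of 0] \<open>F z0 = 0\<close> \<open>R \<le> r\<close> by (cases "z0 = 0") (auto simp: R_def)
  have lim: "((\<lambda>t. norm (F (g t))) \<longlongrightarrow> norm (F (g 1))) (at_left 1)"
    if "continuous_on UNIV g" for g :: "real \<Rightarrow> complex"
  proof -
    have "continuous_on UNIV (\<lambda>t. norm (F (g t)))"
      by (intro continuous_on_norm continuous_on_compose2[OF cont[of UNIV] that]) auto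
    hence "isCont (\<lambda>t. norm (F (g t))) 1" by (simp add: continuous_on_eq_continuous_at)
    thus ?thesis unfolding isCont_def filterlim_at_split by blast
  qed
  have "norm (F (of_real (1 * R))) \<le> norm (F (of_real 1 * z0))"
  proof (rule tendsto_le)
    show "((\<lambda>t. norm (F (of_real (t * R)))) \<longlongrightarrow> norm (F (of_real (1 * R)))) (at_left 1)"
      by (rule lim[of "\<lambda>t. of_real (t * R)"]) (intro continuous_intros)
    show "((\<lambda>t. norm (F (of_real t * z0))) \<longlongrightarrow> norm (F (of_real 1 * z0))) (at_left 1)"
      by (rule lim[of "\<lambda>t. of_real t * z0"]) (intro continuous_intros)
    have "eventually (\<lambda>t. t \<in> {0<..<1::real}) (at_left 1)"
      by (rule eventually_at_leftI[of 0]) auto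
    thus "eventually (\<lambda>t. norm (F (of_real (t * R))) \<le> norm (F (of_real t * z0))) (at_left 1)"
    proof eventually_elim
      case (elim t)
      thus ?case using le[of "of_real t * z0"] \<open>R > 0\<close> by (simp add: norm_mult R_def)
    qed
  qed simp
  thus False using FR \<open>F z0 = 0\<close> by simp
qed

lemma norm_log_deriv_le:
  assumes F: "F holomorphic_on UNIV" "F has_fps_expansion A"
    and A: "fps_nth A 0 \<noteq> 0" "nonneg_fps (- fps_deriv A * inverse A)"
    and nz: "\<And>w. norm w < r \<Longrightarrow> F w \<noteq> 0" and z: "norm z < r"
  shows "norm (deriv F z / F z) \<le> - Re (deriv F (of_real (norm z)) / F (of_real (norm z)))"
proof -
  have hol: "(\<lambda>w. - deriv F w * inverse (F w)) holomorphic_on ball 0 r"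
  proof -
    have "F holomorphic_on ball 0 r" "deriv F holomorphic_on ball 0 r"
      by (rule holomorphic_on_subset[OF F(1) subset_UNIV],
          rule holomorphic_on_subset[OF holomorphic_deriv[OF F(1) open_UNIV] subset_UNIV])
    thus ?thesis using nz by (intro holomorphic_on_mult holomorphic_on_minus holomorphic_on_inverse) auto
  qed
  have "(\<lambda>w. - deriv F w * inverse (F w)) has_fps_expansion (- fps_deriv A * inverse A)"
    by (rule has_fps_expansion_mult[OF has_fps_expansion_minus[OF has_fps_expansion_deriv[OF F(2)]]
              has_fps_expansion_inverse[OF F(2) A(1)]])
  from norm_le_of_nonneg_fps[OF this A(2) hol z] show ?thesis
    by (simp add: divide_inverse norm_mult)
qed

section \<open>The Bessel series and its Dini transforms\<close>

text \<open>For \<open>j = 0\<close> this is the series \<open>\<phi>\<close> of the hypergeometric function \<open>0F1(m; -x)\<close>. The series for \<open>j = 1\<close>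
  and \<open>j = 2\<close> are \<open>F\<close> and \<open>H\<close>. The type is left open because the same series is needed as a complex function
  and, for monotonicity and signs, as a real one.\<close>
definition Bessel_fps :: "nat \<Rightarrow> real \<Rightarrow> nat \<Rightarrow> 'a :: {real_normed_field, banach} fps" where
  "Bessel_fps p m j =
     Abs_fps (\<lambda>n. of_real ((-1) ^ n * (real p * real n + 1) ^ j / (fact n * pochhammer m n)))"

lemma Bessel_fps_Suc:
  "Bessel_fps p m (Suc j) = Bessel_fps p m j + of_nat p * fps_X * fps_deriv (Bessel_fps p m j)"
  (is "_ = ?A + _")
proof (rule fps_ext)
  fix n
  have *: "of_nat p * fps_X * fps_deriv ?A = fps_const (of_nat p) * (fps_X * fps_deriv ?A)"
    by (simp add: fps_of_nat mult.assoc)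
  have "fps_nth (fps_X * fps_deriv ?A) n = of_nat n * fps_nth ?A n"
    by (cases n) simp_all
  hence "fps_nth (?A + of_nat p * fps_X * fps_deriv ?A) n = (1 + of_nat p * of_nat n) * fps_nth ?A n"
    unfolding * by (simp add: algebra_simps)
  also have "\<dots> = fps_nth (Bessel_fps p m (Suc j)) n"
    by (simp add: Bessel_fps_def)
  finally show "fps_nth (Bessel_fps p m (Suc j)) n = fps_nth (?A + of_nat p * fps_X * fps_deriv ?A) n" ..
qed

text \<open>The coefficient form of the differential equation \<open>x \<phi>'' + m \<phi>' + \<phi> = 0\<close>.\<close>
lemma Bessel_fps_recurrence:
  assumes "m > 0"
  shows "of_nat (Suc n) * of_real (m + real n) * fps_nth (Bessel_fps p m 0) (Suc n)
           = - fps_nth (Bessel_fps p m 0) n"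
proof -
  have cancel: "u * v * (- 1 * s / (u * f * (q * v))) = - (s / (f * q))"
    if "u \<noteq> 0" "v \<noteq> 0" for u v s f q :: real
    using that by (cases "f = 0"; cases "q = 0"; simp add: field_simps)
  have "real (Suc n) * (m + real n) * ((-1) ^ Suc n / (fact (Suc n) * pochhammer m (Suc n)))
          = - ((-1) ^ n / (fact n * pochhammer m n))"
    using assms unfolding pochhammer_Suc fact_Suc power_Suc by (intro cancel) auto
  from arg_cong[OF this, of of_real] show ?thesis
    by (simp only: Bessel_fps_def fps_nth_Abs_fps power_0 mult_1_right of_real_mult of_real_minus
        of_real_of_nat_eq)
qed

lemma fps_conv_radius_Bessel: 
  assumes "m > 0"
  shows "fps_conv_radius (Bessel_fps p m j :: 'a :: {real_normed_field, banach} fps) = \<infinity>"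
proof (induction j)
  case 0
  let ?c = "fps_nth (Bessel_fps p m 0 :: 'a fps)"
  have nz: "?c n \<noteq> 0" for n
    using pochhammer_pos[OF assms, of n] by (simp add: Bessel_fps_def)
  have "norm (?c n) / norm (?c (Suc n)) = real (Suc n) * (m + real n)" for n
  proof -
    have "norm (?c n) = norm (of_nat (Suc n) * of_real (m + real n) * ?c (Suc n))"
      by (simp only: Bessel_fps_recurrence[OF assms] norm_minus_cancel)
    also have "\<dots> = real (Suc n) * (m + real n) * norm (?c (Suc n))"
      using assms by (simp only: norm_mult norm_of_nat norm_of_real)
    finally show ?thesis using nz[of "Suc n"] by simp
  qed
  moreover have "filterlim (\<lambda>n. real (Suc n) * (m + real n)) at_top sequentially"
    using assms by real_asymp
  hence "(\<lambda>n. ereal (real (Suc n) * (m + real n))) \<longlonglongrightarrow> \<infinity>"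
    by (simp add: tendsto_PInfty_eq_at_top)
  ultimately have "conv_radius ?c = \<infinity>"
    using nz by (intro conv_radius_ratio_limit_ereal_nonzero) simp_all
  thus ?case by (simp add: fps_conv_radius_def)
next
  case (Suc j)
  let ?A = "Bessel_fps p m j :: 'a fps"
  have "fps_conv_radius (fps_deriv ?A) = \<infinity>"
    using fps_conv_radius_deriv[of ?A] Suc by simp
  moreover have "fps_conv_radius (of_nat p * fps_X :: 'a fps) = \<infinity>"
    using fps_conv_radius_mult[of "of_nat p" "fps_X :: 'a fps"] by simp
  ultimately have "fps_conv_radius (of_nat p * fps_X * fps_deriv ?A) = \<infinity>"
    using fps_conv_radius_mult[of "of_nat p * fps_X" "fps_deriv ?A"] by simp
  thus ?case
    using fps_conv_radius_add[of ?A "of_nat p * fps_X * fps_deriv ?A"] Suc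
    by (simp add: Bessel_fps_Suc)
qed

text \<open>Dividing \<open>x \<phi>'' + m \<phi>' + \<phi> = 0\<close> by \<open>\<phi>\<close> turns it into the Riccati equation for \<open>-\<phi>'/\<phi>\<close>.\<close>
lemma nonneg_fps_Bessel_log_deriv:
  fixes p m
  assumes "m > 0"
  defines "P \<equiv> Bessel_fps p m 0"
  shows "nonneg_fps (- fps_deriv P * inverse P)"
proof (rule nonneg_fps_Riccati[OF assms(1)])
  define Q where "Q = inverse P"
  define V where "V = - fps_deriv P * Q"
  have "fps_nth P 0 \<noteq> 0" by (simp add: P_def Bessel_fps_def)
  hence PQ: "P * Q = 1" and Q': "fps_deriv Q = - fps_deriv P * Q\<^sup>2"
    by (simp_all add: Q_def inverse_mult_eq_1' fps_inverse_deriv)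
  have ode: "fps_X * fps_deriv (fps_deriv P) + fps_const (of_real m) * fps_deriv P = - P"
  proof (rule fps_ext)
    fix n
    show "fps_nth (fps_X * fps_deriv (fps_deriv P) + fps_const (of_real m) * fps_deriv P) n 
            = fps_nth (- P) n"
      using Bessel_fps_recurrence[OF assms(1), of n p, where ?'a = complex]
      by (cases n) (simp_all add: P_def algebra_simps)
  qed
  have "fps_X * fps_deriv V + fps_const (of_real m) * V
          = - (fps_X * fps_deriv (fps_deriv P) + fps_const (of_real m) * fps_deriv P) * Q + fps_X * V\<^sup>2"
    unfolding V_def by (simp add: Q' algebra_simps power2_eq_square)
  also have "\<dots> = P * Q + fps_X * V\<^sup>2" unfolding ode by simp
  finally show "fps_X * fps_deriv (- fps_deriv P * inverse P) + fps_const (of_real m) * (- fps_deriv P * inverse P)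
                  = 1 + fps_X * (- fps_deriv P * inverse P)\<^sup>2"
    using PQ by (simp add: V_def Q_def)
qed

lemma nonneg_fps_Bessel_Dini:
  fixes p m
  assumes "m > 0"
  defines "F \<equiv> Bessel_fps p m 1"
  shows "nonneg_fps (- fps_deriv F * inverse F)" "nonneg_fps (inverse F)"
proof -
  let ?P = "Bessel_fps p m 0 :: complex fps"
  have F: "F = ?P + fps_const (of_nat p) * fps_X * fps_deriv ?P"
    using Bessel_fps_Suc[of p m 0, where ?'a = complex] by (simp add: F_def fps_of_nat)
  have "fps_nth ?P 0 = 1" by (simp add: Bessel_fps_def)
  note * = nonneg_fps_log_deriv_Dini[OF this nonneg_Reals_of_nat_I[of p] nonneg_fps_Bessel_log_deriv[OF assms(1)]]
  show "nonneg_fps (- fps_deriv F * inverse F)" "nonneg_fps (inverse F)"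
    unfolding F by (fact *(1), fact *(2))
qed

lemma eval_Bessel_fps_of_real:
  assumes "m > 0"
  shows "eval_fps (Bessel_fps p m j) (of_real x :: 'a :: {real_normed_field, banach})
           = of_real (eval_fps (Bessel_fps p m j) x)"
proof -
  have "(\<lambda>n. fps_nth (Bessel_fps p m j) n * x ^ n) sums eval_fps (Bessel_fps p m j) x"
    using assms by (intro sums_eval_fps) (simp add: fps_conv_radius_Bessel)
  hence "(\<lambda>n. of_real (fps_nth (Bessel_fps p m j) n * x ^ n)) sums
          (of_real (eval_fps (Bessel_fps p m j) x) :: 'a)"
    by (rule sums_of_real)
  hence "(\<lambda>n. fps_nth (Bessel_fps p m j) n * of_real x ^ n) sums
          (of_real (eval_fps (Bessel_fps p m j) x) :: 'a)"
    by (simp add: Bessel_fps_def)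
  moreover have "(\<lambda>n. fps_nth (Bessel_fps p m j) n * of_real x ^ n) sums
          eval_fps (Bessel_fps p m j) (of_real x :: 'a)"
    using assms by (intro sums_eval_fps) (simp add: fps_conv_radius_Bessel)
  ultimately show ?thesis by (rule sums_unique2[symmetric])
qed

lemma has_field_derivative_eval_Bessel_fps:
  fixes z :: "'a :: {real_normed_field, banach}"
  assumes "m > 0"
  shows "(eval_fps (Bessel_fps p m j) has_field_derivative
           eval_fps (fps_deriv (Bessel_fps p m j)) z) (at z)"
  using assms by (intro has_field_derivative_eval_fps) (simp add: fps_conv_radius_Bessel)

lemma eval_Bessel_fps_Suc:
  fixes z :: "'a :: {real_normed_field, banach}"
  assumes "m > 0"
  shows "eval_fps (Bessel_fps p m (Suc j)) z
           = eval_fps (Bessel_fps p m j) z + of_nat p * z * eval_fps (fps_deriv (Bessel_fps p m j)) z"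
proof -
  let ?A = "Bessel_fps p m j :: 'a fps"
  have A: "fps_conv_radius ?A = \<infinity>" using assms by (rule fps_conv_radius_Bessel)
  have A': "fps_conv_radius (fps_deriv ?A) = \<infinity>"
    using fps_conv_radius_deriv[of ?A] A by simp
  have X: "fps_conv_radius (of_nat p * fps_X :: 'a fps) = \<infinity>"
    using fps_conv_radius_mult[of "of_nat p" "fps_X :: 'a fps"] by simp
  have XA: "fps_conv_radius (of_nat p * fps_X * fps_deriv ?A) = \<infinity>"
    using fps_conv_radius_mult[of "of_nat p * fps_X" "fps_deriv ?A"] X A' by simp
  show ?thesis
    unfolding Bessel_fps_Suc using A A' X XA
    by (simp add: eval_fps_add eval_fps_mult)
qed

text \<open>Differentiation of \<open>z B(a z^p)\<close> is the operator \<open>B \<mapsto> B + p x B'\<close>. Applied with \<open>j = 0\<close> and \<open>j = 1\<close> this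
  computes \<open>f'\<close> and \<open>(z f')'\<close>.\<close>
lemma has_field_derivative_mult_Bessel:
  fixes a z :: "'a :: {real_normed_field, banach}"
  assumes "m > 0" and "p > 0"
  shows "((\<lambda>z. z * eval_fps (Bessel_fps p m j) (a * z ^ p)) has_field_derivative
           eval_fps (Bessel_fps p m (Suc j)) (a * z ^ p)) (at z)"
proof -
  let ?x = "a * z ^ p"
  have zp: "z * z ^ (p - 1) = z ^ p" using assms(2) by (cases p) auto
  have "((\<lambda>z. z * eval_fps (Bessel_fps p m j) (a * z ^ p)) has_field_derivative
           (1 * eval_fps (Bessel_fps p m j) ?x
             + (eval_fps (fps_deriv (Bessel_fps p m j)) ?x * (a * (of_nat p * z ^ (p - 1)))) * z)) (at z)"
    by (intro DERIV_mult DERIV_ident DERIV_chain2[OF has_field_derivative_eval_Bessel_fps[OF assms(1)]])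
       (auto intro!: derivative_eq_intros)
  also have "(eval_fps (fps_deriv (Bessel_fps p m j)) ?x * (a * (of_nat p * z ^ (p - 1)))) * z
             = of_nat p * (a * (z * z ^ (p - 1))) * eval_fps (fps_deriv (Bessel_fps p m j)) ?x"
    by (simp add: mult_ac)
  finally show ?thesis
    by (simp only: zp eval_Bessel_fps_Suc[OF assms(1)] mult_1_left)
qed

section \<open>The radius of convexity as a first zero\<close>

text \<open>The derivative of \<open>t F(t^p)\<close> is \<open>H(t^p) > 0\<close>, so \<open>t F(t^p)\<close> increases from \<open>0\<close>.\<close>
lemma eval_Bessel_fps_1_pos:
  assumes "m > 0" and "p > 0"
    and pos: "\<And>x. 0 \<le> x \<Longrightarrow> x < \<xi> \<Longrightarrow> eval_fps (Bessel_fps p m 2) x > (0 :: real)"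
    and x: "0 \<le> x" "x \<le> \<xi>"
  shows "eval_fps (Bessel_fps p m 1) x > 0"
proof (cases "x = 0")
  case True
  thus ?thesis by (simp add: eval_fps_at_0 Bessel_fps_def)
next
  case False
  define t where "t = root p x"
  have t: "t > 0" "t ^ p = x" using False x assms(2) by (simp_all add: t_def)
  \<comment> \<open>the factor \<open>1\<close> stands for the scale \<open>a\<close> in \<open>has_field_derivative_mult_Bessel\<close>\<close>
  have "0 * eval_fps (Bessel_fps p m 1) (1 * 0 ^ p) < t * eval_fps (Bessel_fps p m 1) (1 * t ^ p)"
  proof (rule DERIV_pos_imp_increasing_open[OF t(1)])
    fix s assume s: "0 < s" "s < t"
    have "s ^ p < t ^ p" using s assms(2) by (intro power_strict_mono) auto
    thus "\<exists>y. ((\<lambda>s. s * eval_fps (Bessel_fps p m 1) (1 * s ^ p)) has_real_derivative y) (at s) \<and> 0 < y"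
      using has_field_derivative_mult_Bessel[OF assms(1,2), of 1 1 s] pos[of "s ^ p"] s t x
      by (intro exI[of _ "eval_fps (Bessel_fps p m (Suc 1)) (1 * s ^ p)"]) (auto simp: numeral_2_eq_2)
  next
    show "continuous_on {0..t} (\<lambda>s. s * eval_fps (Bessel_fps p m 1) (1 * s ^ p))"
      using has_field_derivative_mult_Bessel[OF assms(1,2)] DERIV_isCont
      by (intro continuous_at_imp_continuous_on) blast
  qed
  thus ?thesis using t by (simp add: zero_less_mult_iff)
qed

text \<open>In the disc, \<open>H/F = 1 + p x F'/F\<close> differs from \<open>1\<close> by at most \<open>-p r (F'/F)(r) = 1 - (H/F)(r) < 1\<close>, where
  \<open>r = |x|\<close>.\<close>
lemma Bessel_quotient_half_plane:
  assumes "m > 0" and "p > 0"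
    and pos: "\<And>x. 0 \<le> x \<Longrightarrow> x < \<xi> \<Longrightarrow> eval_fps (Bessel_fps p m 2) x > (0 :: real)"
    and z: "norm (z :: complex) < \<xi>"
  shows "eval_fps (Bessel_fps p m 1) z \<noteq> 0"
    and "Re (eval_fps (Bessel_fps p m 2) z / eval_fps (Bessel_fps p m 1) z) > 0"
proof -
  define A where "A = (Bessel_fps p m 1 :: complex fps)"
  define F where "F = eval_fps A"
  define r where "r = norm z"
  have rad: "fps_conv_radius A = \<infinity>" unfolding A_def by (rule fps_conv_radius_Bessel[OF assms(1)])
  have F: "F holomorphic_on UNIV" "F has_fps_expansion A"
    unfolding F_def using rad by (auto intro!: holomorphic_intros eval_fps_has_fps_expansion)
  have A0: "fps_nth A 0 \<noteq> 0" by (simp add: A_def Bessel_fps_def)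
  have F_real: "F (of_real x) = of_real (eval_fps (Bessel_fps p m 1) x)" for x
    unfolding F_def A_def by (rule eval_Bessel_fps_of_real[OF assms(1)])
  have F_nz: "F w \<noteq> 0" if "norm w < \<xi>" for w
  proof (rule nonzero_on_cball_of_nonneg_inverse[OF F A0 _ _ order.refl])
    show "nonneg_fps (inverse A)"
      unfolding A_def by (rule nonneg_fps_Bessel_Dini[OF assms(1)])
    show "F (of_real x) \<noteq> 0" if "0 \<le> x" "x \<le> norm w" for x
      using eval_Bessel_fps_1_pos[OF assms(1,2) pos, of \<xi> x] that \<open>norm w < \<xi>\<close> by (simp add: F_real)
  qed
  thus "eval_fps (Bessel_fps p m 1) z \<noteq> 0" using z by (simp add: F_def A_def)
  have F': "deriv F w = eval_fps (fps_deriv A) w" for w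
    unfolding F_def A_def
    by (rule DERIV_imp_deriv[OF has_field_derivative_eval_Bessel_fps[OF assms(1)]])
  have G: "eval_fps (Bessel_fps p m 2) w / F w = 1 + of_nat p * w * (deriv F w / F w)"
    if "norm w < \<xi>" for w
  proof -
    have "eval_fps (Bessel_fps p m 2) w = F w + of_nat p * w * deriv F w"
      using eval_Bessel_fps_Suc[OF assms(1), of p 1 w] unfolding F' unfolding F_def A_def
      by (simp add: numeral_2_eq_2)
    thus ?thesis using F_nz[OF that] by (simp add: add_divide_distrib)
  qed
  have le: "norm (deriv F z / F z) \<le> - Re (deriv F (of_real r) / F (of_real r))"
    unfolding r_def using F A0 _ F_nz z
  proof (rule norm_log_deriv_le)
    show "nonneg_fps (- fps_deriv A * inverse A)"
      unfolding A_def by (rule nonneg_fps_Bessel_Dini[OF assms(1)])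
  qed
  have r: "0 \<le> r" "r < \<xi>" using z by (auto simp: r_def)
  have "norm (of_nat p * z * (deriv F z / F z)) = p * r * norm (deriv F z / F z)"
    by (simp add: norm_mult norm_divide r_def)
  also have "\<dots> \<le> p * r * (- Re (deriv F (of_real r) / F (of_real r)))"
    using le r by (intro mult_left_mono) auto
  also have "\<dots> = - Re (of_real (p * r) * (deriv F (of_real r) / F (of_real r)))"
    by (simp only: times_complex.sel Re_complex_of_real Im_complex_of_real mult_zero_left diff_zero mult_minus_right)
  also have "of_real (p * r) * (deriv F (of_real r) / F (of_real r))
               = eval_fps (Bessel_fps p m 2) (of_real r) / F (of_real r) - 1"
    using G[of "of_real r"] r by simp
  also have "\<dots> = of_real (eval_fps (Bessel_fps p m 2) r / eval_fps (Bessel_fps p m 1) r - 1)"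
    unfolding F_real eval_Bessel_fps_of_real[OF assms(1)] by simp
  also have "- Re \<dots> < 1"
    using pos[OF r] eval_Bessel_fps_1_pos[OF assms(1,2) pos, of \<xi> r] r by simp
  finally have "norm (of_nat p * z * (deriv F z / F z)) < 1" .
  hence "Re (1 + of_nat p * z * (deriv F z / F z)) > 0"
    using abs_Re_le_cmod[of "of_nat p * z * (deriv F z / F z)"] by simp
  thus "Re (eval_fps (Bessel_fps p m 2) z / eval_fps (Bessel_fps p m 1) z) > 0"
    using G[OF z] by (simp add: F_def A_def)
qed

text \<open>The half-plane condition holds in the whole disc of radius \<open>\<rho>\<close> and fails at the point \<open>\<rho>\<close>, where
  \<open>1 + z f''/f' = H/F = 0\<close>. So the supremum is attained at \<open>\<rho>\<close>.\<close>
lemma radius_of_convexity_Bessel: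
  fixes f :: "complex \<Rightarrow> complex"
  assumes "m > 0" and "p > 0" and "a > 0" and "\<rho> > 0"
    and f: "\<And>z. f z = z * eval_fps (Bessel_fps p m 0) (of_real a * z ^ p)"
    and zero: "eval_fps (Bessel_fps p m 2) (a * \<rho> ^ p) = 0"
    and pos: "\<And>x. 0 \<le> x \<Longrightarrow> x < a * \<rho> ^ p \<Longrightarrow> eval_fps (Bessel_fps p m 2) x > (0 :: real)"
  shows "radius_of_convexity f = ereal \<rho>"
    and "smallest_positive_root (deriv (\<lambda>z. z * deriv f z)) \<rho>"
proof -
  let ?B = "\<lambda>j z. eval_fps (Bessel_fps p m j) (of_real a * z ^ p) :: complex"
  have f_eq: "f = (\<lambda>z. z * ?B 0 z)" using f by (intro ext)
  have D: "((\<lambda>z. z * ?B j z) has_field_derivative ?B (Suc j) z) (at z)" for j z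
    by (rule has_field_derivative_mult_Bessel[OF assms(1,2)])
  have f': "deriv f = ?B 1"
    unfolding f_eq using DERIV_imp_deriv[OF D[of 0]] by (intro ext) simp
  have zf': "deriv (\<lambda>z. z * deriv f z) = ?B 2"
    unfolding f' using DERIV_imp_deriv[OF D[of 1]] by (intro ext) (simp add: numeral_2_eq_2)
  have B1: "?B 1 holomorphic_on UNIV"
    using assms(1)
    by (intro holomorphic_on_compose_gen[of "\<lambda>z. of_real a * z ^ p" UNIV "eval_fps (Bessel_fps p m 1)" UNIV, unfolded o_def]
          holomorphic_intros) (auto simp: fps_conv_radius_Bessel)
  have f'': "?B 1 z + z * deriv (deriv f) z = ?B 2 z" for z
  proof -
    have "(?B 1 has_field_derivative deriv (?B 1) z) (at z)"
      by (rule holomorphic_derivI[OF B1]) auto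
    from DERIV_mult[OF DERIV_ident this]
    have "((\<lambda>z. z * ?B 1 z) has_field_derivative ?B 1 z + z * deriv (?B 1) z) (at z)"
      by (simp add: mult.commute)
    from DERIV_unique[OF this D[of 1 z]] show ?thesis by (simp add: f' numeral_2_eq_2)
  qed
  have quot: "1 + z * deriv (deriv f) z / deriv f z = ?B 2 z / ?B 1 z" if "?B 1 z \<noteq> 0" for z
    unfolding f''[symmetric] using that by (simp add: f' add_divide_distrib)
  have B_real: "?B j (of_real x) = of_real (eval_fps (Bessel_fps p m j) (a * x ^ p))" for j x
    using eval_Bessel_fps_of_real[OF assms(1), where ?'a = complex, of p j "a * x ^ p"] by simp
  have mono: "a * s ^ p < a * t ^ p" if "0 \<le> s" "s < t" for s t :: real
    using that assms by (intro mult_strict_left_mono power_strict_mono) auto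

  show "smallest_positive_root (deriv (\<lambda>z. z * deriv f z)) \<rho>"
    unfolding smallest_positive_root_def zf'
  proof (intro conjI allI impI)
    fix x assume "0 < x \<and> x < \<rho>"
    thus "?B 2 (of_real x) \<noteq> 0"
      using pos[of "a * x ^ p"] mono[of x \<rho>] assms(3) unfolding B_real by simp
  qed (use assms(4) zero in \<open>simp_all only: B_real of_real_0\<close>)

  have rad: "fps_conv_radius (fps_expansion f 0) = \<infinity>"
  proof -
    have "f holomorphic_on eball 0 \<infinity>"
      unfolding f_eq using D[of 0] by (auto simp: holomorphic_on_open intro: exI)
    from conv_radius_fps_expansion[OF this] show ?thesis by simp
  qed
  show "radius_of_convexity f = ereal \<rho>"
    unfolding radius_of_convexity_def
  proof (rule Sup_eqI)
    fix y assume "y \<in> ereal ` {r. 0 < r \<and> ereal r \<le> fps_conv_radius (fps_expansion f 0) \<and>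
            (\<forall>z\<in>ball 0 r. deriv f z \<noteq> 0 \<and> 0 < Re (1 + z * deriv (deriv f) z / deriv f z))}"
    then obtain r where y: "y = ereal r"
      and r: "\<And>z. z \<in> ball 0 r \<Longrightarrow> deriv f z \<noteq> 0 \<and> 0 < Re (1 + z * deriv (deriv f) z / deriv f z)"
      by auto
    have "r \<le> \<rho>"
    proof (rule ccontr)
      assume "\<not> r \<le> \<rho>"
      hence nz: "?B 1 (of_real \<rho>) \<noteq> 0" and
        "0 < Re (1 + of_real \<rho> * deriv (deriv f) (of_real \<rho>) / deriv f (of_real \<rho>))"
        using r[of "of_real \<rho>"] assms(4) unfolding f' by auto
      hence "0 < Re (?B 2 (of_real \<rho>) / ?B 1 (of_real \<rho>))"
        by (simp only: quot[OF nz])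
      thus False unfolding B_real[of 2] zero by simp
    qed
    thus "y \<le> ereal \<rho>" by (simp add: y)
  next
    fix y :: ereal
    assume *: "\<And>x. x \<in> ereal ` {r. 0 < r \<and> ereal r \<le> fps_conv_radius (fps_expansion f 0) \<and>
            (\<forall>z\<in>ball 0 r. deriv f z \<noteq> 0 \<and> 0 < Re (1 + z * deriv (deriv f) z / deriv f z))} \<Longrightarrow> x \<le> y"
    have "deriv f z \<noteq> 0 \<and> 0 < Re (1 + z * deriv (deriv f) z / deriv f z)" if "z \<in> ball 0 \<rho>" for z
    proof -
      have "norm (of_real a * z ^ p) < a * \<rho> ^ p"
        using mono[of "norm z" \<rho>] that assms(3) by (simp add: norm_mult norm_power)
      note half_plane = Bessel_quotient_half_plane[OF assms(1,2) pos this]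
      show ?thesis using half_plane quot[of z] by (simp add: f')
    qed
    thus "ereal \<rho> \<le> y" using rad assms(4) by (intro *) auto
  qed
qed

section \<open>Localisation of the first zero\<close>

definition Bessel_term :: "nat \<Rightarrow> real \<Rightarrow> real \<Rightarrow> nat \<Rightarrow> real" where
  "Bessel_term p m x n = (real p * real n + 1)\<^sup>2 * x ^ n / (fact n * pochhammer m n)"

text \<open>The ratio of successive terms is
  \<open>((pn + p + 1)/(pn + 1))^2 x / ((n + 1)(m + n))\<close>, and its first factor is at most \<open>(p + 1)^2\<close>.\<close>
lemma Bessel_term_decreasing:
  assumes "m > 0" and "x \<ge> 0" and N: "(real p + 1)\<^sup>2 * x \<le> (real N + 1) * (m + real N)" and "N \<le> n"
  shows "0 \<le> Bessel_term p m x n" and "Bessel_term p m x (Suc n) \<le> Bessel_term p m x n"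
proof -
  define q where "q = pochhammer m n"
  have q: "q > 0" unfolding q_def using assms(1) by (rule pochhammer_pos)
  show nonneg: "0 \<le> Bessel_term p m x n"
    using q assms(2) by (simp add: Bessel_term_def q_def)
  define u where "u = real p * real n + 1"
  define d where "d = (real n + 1) * (m + real n)"
  have "u \<ge> 1" "d > 0" using assms(1) by (auto simp: u_def d_def intro!: mult_pos_pos add_pos_nonneg)
  have "(real p * real (Suc n) + 1) \<le> (real p + 1) * u"
    by (simp add: u_def algebra_simps)
  hence "(real p * real (Suc n) + 1)\<^sup>2 \<le> ((real p + 1) * u)\<^sup>2"
    by (intro power_mono) auto
  hence "(real p * real (Suc n) + 1)\<^sup>2 * x \<le> ((real p + 1) * u)\<^sup>2 * x"
    using assms(2) by (intro mult_right_mono)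
  also have "\<dots> = u\<^sup>2 * ((real p + 1)\<^sup>2 * x)" by (simp add: power_mult_distrib)
  also have "(real p + 1)\<^sup>2 * x \<le> d"
  proof -
    have "(real N + 1) * (m + real N) \<le> d"
      unfolding d_def using assms(1,4) by (intro mult_mono) auto
    thus ?thesis using N by simp
  qed
  finally have le: "(real p * real (Suc n) + 1)\<^sup>2 * x \<le> u\<^sup>2 * d" by (simp add: mult_left_mono)
  have "Bessel_term p m x (Suc n) = ((real p * real (Suc n) + 1)\<^sup>2 * x) * (x ^ n / (d * (fact n * q)))"
    by (simp add: Bessel_term_def pochhammer_Suc q_def d_def mult_ac add.commute)
  also have "\<dots> \<le> (u\<^sup>2 * d) * (x ^ n / (d * (fact n * q)))"
    using le q \<open>d > 0\<close> assms(2) by (intro mult_right_mono) auto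
  also have "\<dots> = Bessel_term p m x n"
    using \<open>d > 0\<close> by (simp add: Bessel_term_def u_def q_def)
  finally show "Bessel_term p m x (Suc n) \<le> Bessel_term p m x n" .
qed

text \<open>Leibniz' criterion, applied to the tail that begins with the term of index \<open>2N\<close>, where the terms
  start to decrease.\<close>
lemma eval_Bessel_2_between:
  assumes "m > 0" and "x \<ge> 0"
    and N: "(real p + 1)\<^sup>2 * x \<le> (real (2 * N) + 1) * (m + real (2 * N))"
  shows "(\<Sum>i<2 * N + 2. (-1) ^ i * Bessel_term p m x i) \<le> eval_fps (Bessel_fps p m 2) x"
    and "eval_fps (Bessel_fps p m 2) x \<le> (\<Sum>i<2 * N + 1. (-1) ^ i * Bessel_term p m x i)"
proof -
  let ?T = "Bessel_term p m x"
  define a where "a i = ?T (i + 2 * N)" for i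
  have sums: "(\<lambda>n. (-1) ^ n * ?T n) sums eval_fps (Bessel_fps p m 2) x"
  proof -
    have "(\<lambda>n. fps_nth (Bessel_fps p m 2) n * x ^ n) sums eval_fps (Bessel_fps p m 2) x"
      using assms(1) by (intro sums_eval_fps) (simp add: fps_conv_radius_Bessel)
    moreover have "fps_nth (Bessel_fps p m 2) n * x ^ n = (-1) ^ n * ?T n" for n
      by (simp add: Bessel_fps_def Bessel_term_def)
    ultimately show ?thesis by simp
  qed
  have dec: "0 \<le> a n" "a (Suc n) \<le> a n" for n
    using Bessel_term_decreasing[OF assms, of "n + 2 * N"] by (simp_all add: a_def)
  have "(\<lambda>n. norm ((-1) ^ n * ?T n)) \<longlonglongrightarrow> 0"
    using sums summable_LIMSEQ_zero tendsto_norm_zero sums_summable by blast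
  hence "(\<lambda>n. \<bar>?T n\<bar>) \<longlonglongrightarrow> 0" by (simp add: abs_mult power_abs)
  hence "?T \<longlonglongrightarrow> 0" by (simp only: tendsto_rabs_zero_iff)
  hence lim: "a \<longlonglongrightarrow> 0" unfolding a_def by (rule LIMSEQ_ignore_initial_segment)
  have split: "eval_fps (Bessel_fps p m 2) x = (\<Sum>i. (-1) ^ i * a i) + (\<Sum>i<2 * N. (-1) ^ i * ?T i)"
    using suminf_split_initial_segment[OF sums_summable[OF sums], of "2 * N"] sums_unique[OF sums]
    by (simp add: a_def power_add)
  have "(\<Sum>i<2 * 1. (-1) ^ i * a i) \<le> (\<Sum>i. (-1) ^ i * a i)"
    using lim dec by (rule summable_Leibniz')
  thus "(\<Sum>i<2 * N + 2. (-1) ^ i * ?T i) \<le> eval_fps (Bessel_fps p m 2) x"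
    unfolding split by (simp add: a_def numeral_2_eq_2 power_add)
  have "(\<Sum>i. (-1) ^ i * a i) \<le> (\<Sum>i<2 * 0 + 1. (-1) ^ i * a i)"
    using lim dec by (rule summable_Leibniz')
  thus "eval_fps (Bessel_fps p m 2) x \<le> (\<Sum>i<2 * N + 1. (-1) ^ i * ?T i)"
    unfolding split by (simp add: a_def)
qed

text \<open>The first pair of terms gives \<open>1 - (p + 1)^2 x / m \<ge> 0\<close>, with equality at the end of the interval. Strict
  positivity comes from the second pair, where the ratio of the terms is at most \<open>1/3\<close>.\<close>
lemma eval_Bessel_2_pos:
  assumes "m > 0" and "0 \<le> x" and x: "(real p + 1)\<^sup>2 * x \<le> m"
  shows "eval_fps (Bessel_fps p m 2) x > (0 :: real)"
proof (cases "x = 0")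
  case True
  thus ?thesis by (simp add: eval_fps_at_0 Bessel_fps_def)
next
  case False
  let ?T = "Bessel_term p m x"
  have "?T 3 < ?T 2"
  proof -
    have "(real p * 3 + 1)\<^sup>2 * x \<le> ((real p + 1) * (real p * 2 + 1))\<^sup>2 * x"
      using assms(2) by (intro mult_right_mono power_mono) (auto simp: algebra_simps)
    also have "\<dots> = (real p * 2 + 1)\<^sup>2 * ((real p + 1)\<^sup>2 * x)" by (simp add: power_mult_distrib)
    also have "\<dots> < (real p * 2 + 1)\<^sup>2 * (3 * (m + 2))"
      using x assms(1) by (intro mult_strict_left_mono) (auto intro: add_nonneg_pos)
    finally have "(real p * 3 + 1)\<^sup>2 * x * (x\<^sup>2 / (6 * m * (m + 1) * (m + 2)))
        < (real p * 2 + 1)\<^sup>2 * (3 * (m + 2)) * (x\<^sup>2 / (6 * m * (m + 1) * (m + 2)))"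
      using assms(1,2) False by (intro mult_strict_right_mono) auto
    also have "\<dots> = (real p * 2 + 1)\<^sup>2 * x\<^sup>2 / (2 * m * (m + 1))"
      using assms(1) by (simp add: divide_simps) (simp add: algebra_simps)
    finally show ?thesis
      by (simp add: Bessel_term_def eval_nat_numeral pochhammer_Suc algebra_simps)
  qed
  moreover have "?T 1 \<le> ?T 0"
    using x assms(1) by (simp add: Bessel_term_def add.commute)
  moreover have "(real p + 1)\<^sup>2 * x \<le> (real (2 * 1) + 1) * (m + real (2 * 1))"
    using x assms(1) by simp
  from eval_Bessel_2_between(1)[OF assms(1,2) this]
  have "?T 0 - ?T 1 + (?T 2 - ?T 3) \<le> eval_fps (Bessel_fps p m 2) x"
    by (simp add: eval_nat_numeral)
  ultimately show ?thesis by linarith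
qed

text \<open>Three terms of the series suffice here. The evaluation point is \<open>\<sigma>\<^sub>1/\<sigma>\<^sub>2\<close>, where
  \<open>\<sigma>\<^sub>1 = 9/m\<close> and \<open>\<sigma>\<^sub>2 = 81/m^2 - 25/(m (m + 1))\<close>.\<close>
lemma eval_Bessel_2_neg_quadratic:
  assumes "m > 0"
  shows "eval_fps (Bessel_fps 2 m 2) (9 * m * (m + 1) / (56 * m + 81)) < (0 :: real)"
proof -
  define D where "D = 56 * m + 81"
  define x where "x = 9 * m * (m + 1) / D"
  have D: "D > 0" using assms by (simp add: D_def add_pos_pos)
  have x0: "x \<ge> 0" using assms D by (simp add: x_def)
  have "9 * x \<le> 3 * (m + 2)"
    using D assms by (simp add: x_def D_def field_simps)
  hence "(real 2 + 1)\<^sup>2 * x \<le> (real (2 * 1) + 1) * (m + real (2 * 1))" by simp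
  from eval_Bessel_2_between(2)[OF assms x0 this]
  have "eval_fps (Bessel_fps 2 m 2) x \<le> 1 - 9 * x / m + 25 * x\<^sup>2 / (2 * (m * (m + 1)))"
    by (simp add: Bessel_term_def eval_nat_numeral pochhammer_Suc algebra_simps)
  also have "9 * x / m = 81 * (m + 1) / D" using assms D by (simp add: x_def)
  also have "25 * x\<^sup>2 / (2 * (m * (m + 1))) = 2025 * m * (m + 1) / (2 * D\<^sup>2)"
    using assms D by (simp add: x_def power2_eq_square divide_simps)
  also have "1 - 81 * (m + 1) / D + 2025 * m * (m + 1) / (2 * D\<^sup>2) = - 25 * m * (31 * m + 81) / (2 * D\<^sup>2)"
    using D by (simp add: divide_simps) (simp add: D_def algebra_simps power2_eq_square)
  also have "\<dots> < 0" using assms D by (simp add: divide_neg_pos)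
  finally show ?thesis by (simp add: x_def D_def)
qed

text \<open>The evaluation point is \<open>\<sigma>\<^sub>1/\<sigma>\<^sub>2\<close> with \<open>\<sigma>\<^sub>1 = 4/m\<close> and \<open>\<sigma>\<^sub>2 = 16/m^2 - 9/(m (m + 1))\<close>. The sum
  of the first three terms equals \<open>9 m (m - 8) / (7 m + 16)^2\<close> and is positive for large \<open>m\<close>, so two more
  terms are taken into account.\<close>
lemma eval_Bessel_2_neg_linear:
  assumes "m > 0"
  shows "eval_fps (Bessel_fps 1 m 2) (4 * m * (m + 1) / (7 * m + 16)) < (0 :: real)"
proof -
  define D where "D = 7 * m + 16"
  define x where "x = 4 * m * (m + 1) / D"
  have D: "D > 0" using assms by (simp add: D_def add_pos_pos)
  have x0: "x \<ge> 0" using assms D by (simp add: x_def)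
  have "4 * x \<le> 5 * (m + 4)"
    using D assms by (simp add: x_def D_def field_simps) 
  hence "(real 1 + 1)\<^sup>2 * x \<le> (real (2 * 2) + 1) * (m + real (2 * 2))" by simp
  from eval_Bessel_2_between(2)[OF assms x0 this]
  have "eval_fps (Bessel_fps 1 m 2) x \<le> 1 - 4 * x / m + 9 * x\<^sup>2 / (2 * (m * (m + 1)))
          - 16 * x ^ 3 / (6 * (m * (m + 1) * (m + 2))) + 25 * x ^ 4 / (24 * (m * (m + 1) * (m + 2) * (m + 3)))"
    by (simp add: Bessel_term_def eval_nat_numeral pochhammer_Suc algebra_simps)
  also have "4 * x / m = 16 * (m + 1) / D" using assms D by (simp add: x_def)
  also have "9 * x\<^sup>2 / (2 * (m * (m + 1))) = 72 * m * (m + 1) / D\<^sup>2"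
    using assms D by (simp add: x_def power2_eq_square divide_simps)
  also have "16 * x ^ 3 / (6 * (m * (m + 1) * (m + 2))) = 512 * m\<^sup>2 * (m + 1)\<^sup>2 / (3 * D ^ 3 * (m + 2))"
    using assms D by (simp add: x_def power2_eq_square power3_eq_cube divide_simps)
  also have "25 * x ^ 4 / (24 * (m * (m + 1) * (m + 2) * (m + 3))) 
              = 800 * m ^ 3 * (m + 1) ^ 3 / (3 * D ^ 4 * (m + 2) * (m + 3))"
    using assms D by (simp add: x_def power4_eq_xxxx power3_eq_cube divide_simps)
  \<comment> \<open>over the common denominator, the numerator expands to a polynomial whose coefficients are all negative\<close>
  also have "1 - 16 * (m + 1) / D + 72 * m * (m + 1) / D\<^sup>2 - 512 * m\<^sup>2 * (m + 1)\<^sup>2 / (3 * D ^ 3 * (m + 2))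
      + 800 * m ^ 3 * (m + 1) ^ 3 / (3 * D ^ 4 * (m + 2) * (m + 3))
      = - m * (1461 * m ^ 5 + 21633 * m ^ 4 + 119862 * m ^ 3 + 357168 * m\<^sup>2 + 549888 * m + 331776)
          / (3 * D ^ 4 * (m + 2) * (m + 3))"
    using D assms by (simp add: divide_simps) (simp add: D_def algebra_simps eval_nat_numeral)
  also have "\<dots> < 0" using assms D
    by (intro divide_neg_pos mult_neg_pos mult_pos_pos add_pos_pos) auto
  finally show ?thesis by (simp add: x_def D_def)
qed

text \<open>The minimum of the compact set of points in \<open>[lo, up]\<close> where \<open>H \<le> 0\<close>.\<close>
lemma eval_Bessel_2_first_zero:
  assumes "m > 0" and "0 < lo" "lo < up"
    and pos: "\<And>x. 0 \<le> x \<Longrightarrow> x \<le> lo \<Longrightarrow> eval_fps (Bessel_fps p m 2) x > (0 :: real)"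
    and neg: "eval_fps (Bessel_fps p m 2) up < (0 :: real)"
  obtains \<xi> where "lo < \<xi>" "\<xi> < up" "eval_fps (Bessel_fps p m 2) \<xi> = 0"
    "\<And>x. 0 \<le> x \<Longrightarrow> x < \<xi> \<Longrightarrow> eval_fps (Bessel_fps p m 2) x > 0"
proof -
  define H :: "real \<Rightarrow> real" where "H = eval_fps (Bessel_fps p m 2)"
  have cont: "continuous_on X H" for X
    using has_field_derivative_eval_Bessel_fps[OF assms(1), where ?'a = real] DERIV_isCont
    unfolding H_def by (intro continuous_at_imp_continuous_on) blast
  define Z where "Z = {lo..up} \<inter> H -` {..0}"
  have "compact Z"
    unfolding Z_def by (intro compact_Int_closed closed_vimage cont) auto
  moreover have "up \<in> Z" using neg assms(3) by (simp add: Z_def H_def)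
  ultimately obtain \<xi> where \<xi>: "\<xi> \<in> Z" "\<And>x. x \<in> Z \<Longrightarrow> \<xi> \<le> x"
    using compact_attains_inf[of Z] by blast
  have posH: "H x > 0" if "0 \<le> x" "x < \<xi>" for x
  proof (cases "x \<le> lo")
    case True
    thus ?thesis using pos that by (simp add: H_def)
  next
    case False
    thus ?thesis using \<xi>(2)[of x] \<xi>(1) that by (force simp: Z_def)
  qed
  have \<xi>_le: "lo \<le> \<xi>" "\<xi> \<le> up" "H \<xi> \<le> 0" using \<xi>(1) by (auto simp: Z_def)
  have "\<xi> \<noteq> lo" using pos[of lo] \<xi>_le assms(2) by (auto simp: H_def)
  have "H \<xi> = 0"
  proof -
    have "\<exists>x. 0 \<le> x \<and> x \<le> \<xi> \<and> H x = 0"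
      using \<xi>_le pos[of 0] assms(2) cont by (intro IVT2') (auto simp: H_def)
    then obtain x where "0 \<le> x" "x \<le> \<xi>" "H x = 0" by blast
    thus ?thesis using posH[of x] by (cases "x = \<xi>") auto
  qed
  moreover have "\<xi> \<noteq> up" using neg \<open>H \<xi> = 0\<close> by (auto simp: H_def)
  ultimately show ?thesis
    using that[of \<xi>] \<xi>_le \<open>\<xi> \<noteq> lo\<close> posH by (simp add: H_def)
qed

section \<open>The k-gamma function and the normalised k-Bessel functions\<close>

text \<open>The substitution \<open>x = t^k / k\<close> in Euler's integral.\<close>
lemma k_gamma_of_real:
  assumes k: "k > 0" and s: "s > 0"
  shows "k_gamma k (of_real s) = of_real (k powr (s / k - 1) * Gamma (s / k))"
proof -
  define f where "f = (\<lambda>x::real. x powr (s / k - 1) / exp x)"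
  define g where "g = (\<lambda>t::real. t powr k / k)"
  define r where "r = (\<lambda>t. t powr (s - 1) * exp (- (t powr k) / k))"
  have spike: "(u has_integral y) {0..} \<longleftrightarrow> (u has_integral y) {0<..}" for u :: "real \<Rightarrow> real" and y
    by (rule has_integral_spike_set_eq; rule negligible_subset[of "{0::real}"]; force)
  have "s / k > 0" using k s by simp
  hence "(f has_integral Gamma (s / k)) {0..}"
    unfolding f_def by (rule Gamma_integral_real)
  hence f: "(f has_integral Gamma (s / k)) {0<..}"
    by (simp only: spike)
  have absf: "f absolutely_integrable_on {0<..}"
    using f by (intro nonnegative_absolutely_integrable_1) (auto simp: f_def has_integral_integrable)
  have img: "g ` {0<..} = {0<..}"
  proof (intro equalityI subsetI)
    fix x :: real assume x: "x \<in> {0<..}"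
    have "((k * x) powr (1 / k)) powr k = k * x"
      using k x by (simp add: powr_powr)
    hence "x = g ((k * x) powr (1 / k))" using k by (simp add: g_def)
    thus "x \<in> g ` {0<..}" using k x by (intro image_eqI[of _ _ "(k * x) powr (1 / k)"]) auto
  qed (use k in \<open>auto simp: g_def\<close>)
  have inj: "inj_on g {0<..}"
    by (rule inj_on_inverseI[of _ "\<lambda>x. (k * x) powr (1 / k)"]) (use k in \<open>simp add: g_def powr_powr\<close>)
  have "((\<lambda>t. \<bar>t powr (k - 1)\<bar> * f (g t)) absolutely_integrable_on {0<..} \<and>
          integral {0<..} (\<lambda>t. \<bar>t powr (k - 1)\<bar> * f (g t)) = Gamma (s / k))"
  proof (subst has_absolute_integral_change_of_variables_1'[of "{0<..}" g "\<lambda>t. t powr (k - 1)" f])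
    show "(g has_field_derivative x powr (k - 1)) (at x within {0<..})" if "x \<in> {0<..}" for x
      unfolding g_def using that k by (auto intro!: derivative_eq_intros)
  qed (use absf f img inj integral_unique in auto)
  hence "((\<lambda>t. \<bar>t powr (k - 1)\<bar> * f (g t)) has_integral Gamma (s / k)) {0<..}"
    by (auto simp: has_integral_iff set_lebesgue_integral_eq_integral)
  hence "((\<lambda>t. k powr (s / k - 1) * (\<bar>t powr (k - 1)\<bar> * f (g t))) has_integral
           k powr (s / k - 1) * Gamma (s / k)) {0<..}"
    by (rule has_integral_mult_right)
  moreover have "k powr (s / k - 1) * (\<bar>t powr (k - 1)\<bar> * f (g t)) = r t" if "t \<in> {0<..}" for t
  proof -
    have "(t powr k / k) powr (s / k - 1) = t powr (s - k) / k powr (s / k - 1)"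
      using that k by (simp add: powr_divide powr_powr algebra_simps)
    moreover have "t powr (k - 1) * t powr (s - k) = t powr (s - 1)"
      by (simp flip: powr_add)
    ultimately show ?thesis
      using k unfolding f_def g_def r_def by (simp add: exp_minus field_simps)
  qed
  ultimately have "(r has_integral k powr (s / k - 1) * Gamma (s / k)) {0<..}"
    by (rule has_integral_eq[rotated])
  hence "(r has_integral k powr (s / k - 1) * Gamma (s / k)) {0..}"
    by (simp only: spike)
  from has_integral_linear[OF this bounded_linear_of_real]
  have "((\<lambda>t. complex_of_real (r t)) has_integral of_real (k powr (s / k - 1) * Gamma (s / k))) {0..}"
    by (simp add: o_def)
  moreover have "complex_of_real (r t)
       = of_real t powr (of_real s - 1) * of_real (exp (- (t powr k) / k))" if "t \<in> {0..}" for t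
    using that powr_of_real[of t "s - 1"] by (simp add: r_def)
  ultimately have "((\<lambda>t. of_real t powr (of_real s - 1) * of_real (exp (- (t powr k) / k))) has_integral
      complex_of_real (k powr (s / k - 1) * Gamma (s / k))) {0..}"
    by (rule has_integral_eq[rotated])
  thus ?thesis unfolding k_gamma_def by (rule integral_unique)
qed

lemma k_gamma_pochhammer:
  assumes "k > 0" and "\<nu> > 0"
  shows "k_gamma k (of_real (real n * k + \<nu> + k))
           = of_real (k ^ n * pochhammer (\<nu> / k + 1) n) * k_gamma k (of_real (\<nu> + k))"
    and "k_gamma k (of_real (\<nu> + k)) \<noteq> 0"
proof -
  define m where "m = \<nu> / k + 1"
  have "m > 0" using assms by (simp add: m_def add_pos_pos)
  have div: "(real i * k + \<nu> + k) / k = real i + m" for i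
    using assms by (simp add: m_def field_simps)
  have G: "k_gamma k (of_real (real i * k + \<nu> + k)) = of_real (k powr (real i + m - 1) * Gamma (real i + m))" for i
    using k_gamma_of_real[of k "real i * k + \<nu> + k"] assms unfolding div by (simp add: add_pos_pos add_nonneg_pos)
  have "Gamma m > 0" using \<open>m > 0\<close> by (rule Gamma_real_pos)
  have "m \<notin> \<int>\<^sub>\<le>\<^sub>0" using \<open>m > 0\<close> by (auto elim!: nonpos_Ints_cases)
  hence "Gamma (real n + m) = pochhammer m n * Gamma m"
    using pochhammer_Gamma[of m n] \<open>Gamma m > 0\<close> by (simp add: add.commute)
  moreover have "k powr (real n + m - 1) = k ^ n * k powr (m - 1)"
    using assms powr_add[of k "real n" "m - 1"] by (simp add: powr_realpow algebra_simps)
  ultimately show "k_gamma k (of_real (real n * k + \<nu> + k))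
           = of_real (k ^ n * pochhammer (\<nu> / k + 1) n) * k_gamma k (of_real (\<nu> + k))"
    using G[of n] G[of 0] by (simp add: m_def[symmetric])
  show "k_gamma k (of_real (\<nu> + k)) \<noteq> 0"
    using G[of 0] \<open>Gamma m > 0\<close> assms by simp
qed

text \<open>Pulling \<open>(w/2)^(\<nu>/k)\<close> out of the series leaves a power series in \<open>w^2\<close>. The parameter \<open>p\<close> is free, as the
  coefficients with \<open>j = 0\<close> do not depend on it.\<close>
lemma k_Bessel_eq_eval_fps:
  assumes "k > 0" and "\<nu> > 0" and "w \<noteq> 0"
  shows "k_gamma k (of_real (\<nu> + k)) * k_Bessel k \<nu> c w
           = (w / 2) powr of_real (\<nu> / k)
              * eval_fps (Bessel_fps p (\<nu> / k + 1) 0) (of_real (c / (4 * k)) * w\<^sup>2)"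
proof -
  define K where "K = k_gamma k (of_real (\<nu> + k))"
  define B where "B = (Bessel_fps p (\<nu> / k + 1) 0 :: complex fps)"
  define x where "x = of_real (c / (4 * k)) * w\<^sup>2"
  have K: "K \<noteq> 0" unfolding K_def using assms by (intro k_gamma_pochhammer)
  have "\<nu> / k + 1 > 0" using assms by (simp add: add_pos_pos)
  have coeff: "of_real ((- c) ^ n) / (fact n * k_gamma k (of_real (real n * k + \<nu> + k)))
           * (w / 2) powr of_real (2 * real n + \<nu> / k)
         = (w / 2) powr of_real (\<nu> / k) / K * (fps_nth B n * x ^ n)" (is "?l = ?r") for n
  proof -
    have "(w / 2) powr of_real (2 * real n + \<nu> / k)
            = (w / 2) powr of_nat (2 * n) * (w / 2) powr of_real (\<nu> / k)"
      by (simp add: powr_add)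
    also have "(w / 2) powr of_nat (2 * n) = (w / 2) ^ (2 * n)"
      using assms(3) by (intro powr_nat') auto
    also have "\<dots> = (w\<^sup>2 / 4) ^ n"
      by (simp add: power_mult power_divide)
    finally have pw: "(w / 2) powr of_real (2 * real n + \<nu> / k)
            = (w\<^sup>2 / 4) ^ n * (w / 2) powr of_real (\<nu> / k)" .
    have "x ^ n = of_real (c ^ n) / of_real (k ^ n) * (w\<^sup>2 / 4) ^ n"
      using assms(1) by (simp add: x_def power_mult_distrib power_divide)
    moreover have "(- c) ^ n = (- 1) ^ n * c ^ n" by (rule power_minus)
    ultimately show ?thesis
      unfolding pw k_gamma_pochhammer(1)[OF assms(1,2)] K_def[symmetric]
      using K assms(1) by (simp add: B_def Bessel_fps_def mult_ac)
  qed
  have "(\<lambda>n. fps_nth B n * x ^ n) sums eval_fps B x"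
    unfolding B_def using \<open>\<nu> / k + 1 > 0\<close>
    by (intro sums_eval_fps) (simp add: fps_conv_radius_Bessel)
  from sums_mult[OF this, of "(w / 2) powr of_real (\<nu> / k) / K"]
  have "k_Bessel k \<nu> c w = (w / 2) powr of_real (\<nu> / k) / K * eval_fps B x"
    unfolding k_Bessel_def coeff by (rule sums_unique[symmetric])
  thus ?thesis using K by (simp add: K_def B_def x_def)
qed

text \<open>Dividing by a positive number subtracts a real number from the principal logarithm, on the branch cut too.\<close>
lemma powr_half_of_real:
  fixes z :: complex
  assumes "z \<noteq> 0"
  shows "of_real (2 powr s) * (z / 2) powr of_real s = z powr of_real s"
proof -
  have "z / 2 = of_real (1 / 2) * z" by simp
  hence "Ln (z / 2) = of_real (ln (1 / 2)) + Ln z"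
    using assms Ln_times_of_real[of "1 / 2" z] Ln_of_real[of "1 / 2"] by simp
  also have "ln (1 / 2) = - ln (2 :: real)" by (simp add: ln_div)
  finally have L: "Ln (z / 2) = Ln z - of_real (ln 2)" by simp
  have "(z / 2) powr of_real s = exp (of_real s * Ln z) * exp (of_real (- s * ln 2))"
    unfolding powr_def L using assms by (simp add: algebra_simps flip: exp_add)
  moreover have "complex_of_real (2 powr s) = exp (of_real (s * ln 2))"
    by (simp add: powr_def flip: exp_of_real)
  ultimately show ?thesis
    using assms by (simp add: powr_def exp_minus)
qed

lemma k_Bessel_g_eq:
  assumes "k > 0" and "\<nu> > 0"
  shows "k_Bessel_g k \<nu> c z
           = z * eval_fps (Bessel_fps 2 (\<nu> / k + 1) 0) (of_real (c / (4 * k)) * z ^ 2)"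
proof (cases "z = 0")
  case False
  let ?E = "eval_fps (Bessel_fps 2 (\<nu> / k + 1) 0) (of_real (c / (4 * k)) * z ^ 2)"
  have "k_Bessel_g k \<nu> c z = of_real (2 powr (\<nu> / k)) * z powr of_real (1 - \<nu> / k)
          * (k_gamma k (of_real (\<nu> + k)) * k_Bessel k \<nu> c z)"
    unfolding k_Bessel_g_def by (simp only: mult_ac)
  also have "\<dots> = z powr of_real (1 - \<nu> / k) * (of_real (2 powr (\<nu> / k)) * (z / 2) powr of_real (\<nu> / k)) * ?E"
    unfolding k_Bessel_eq_eval_fps[OF assms False, of c 2] by (simp only: mult_ac)
  also have "\<dots> = z powr of_real (1 - \<nu> / k) * z powr of_real (\<nu> / k) * ?E"
    by (simp only: powr_half_of_real[OF False])
  also have "z powr of_real (1 - \<nu> / k) * z powr of_real (\<nu> / k) = z"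
    using False by (simp flip: powr_add)
  finally show ?thesis .
qed (simp add: k_Bessel_g_def)

text \<open>Halving the principal logarithm keeps its imaginary part in the principal range.\<close>
lemma csqrt_powr:
  "csqrt z powr s = z powr (s / 2)"
proof (cases "z = 0")
  case False
  have L: "Ln (csqrt z) = Ln z / 2"
    unfolding csqrt_exp_Ln[OF False]
    using mpi_less_Im_Ln[OF False] Im_Ln_le_pi[OF False] by (intro Ln_exp) auto
  show ?thesis using False unfolding powr_def by (simp add: L)
qed simp

lemma k_Bessel_h_eq:
  assumes "k > 0" and "\<nu> > 0"
  shows "k_Bessel_h k \<nu> c z
           = z * eval_fps (Bessel_fps 1 (\<nu> / k + 1) 0) (of_real (c / (4 * k)) * z ^ 1)"
proof (cases "z = 0")
  case False
  hence w: "csqrt z \<noteq> 0" by simp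
  let ?E = "eval_fps (Bessel_fps 1 (\<nu> / k + 1) 0) (of_real (c / (4 * k)) * z ^ 1)"
  have "k_Bessel_h k \<nu> c z = of_real (2 powr (\<nu> / k)) * z powr of_real (1 - \<nu> / (2 * k))
          * (k_gamma k (of_real (\<nu> + k)) * k_Bessel k \<nu> c (csqrt z))"
    unfolding k_Bessel_h_def by (simp only: mult_ac)
  also have "\<dots> = z powr of_real (1 - \<nu> / (2 * k))
                  * (of_real (2 powr (\<nu> / k)) * (csqrt z / 2) powr of_real (\<nu> / k)) * ?E"
    unfolding k_Bessel_eq_eval_fps[OF assms w, of c 1] by (simp only: mult_ac power2_csqrt power_one_right)
  also have "\<dots> = z powr of_real (1 - \<nu> / (2 * k)) * z powr (of_real (\<nu> / k) / 2) * ?E"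
    by (simp only: powr_half_of_real[OF w] csqrt_powr)
  also have "z powr of_real (1 - \<nu> / (2 * k)) * z powr (of_real (\<nu> / k) / 2) = z"
    using False by (simp flip: powr_add)
  finally show ?thesis .
qed (simp add: k_Bessel_h_def)

section \<open>The two radii of convexity\<close>

theorem theorem1p4:
  fixes k c \<nu> :: real
  assumes "k > 0" and "c > 0" and "\<nu> > 0"
  shows "(\<exists>\<rho>::real. radius_of_convexity (k_Bessel_g k \<nu> c) = ereal \<rho> \<and>
            smallest_positive_root (deriv (\<lambda>z. z * deriv (k_Bessel_g k \<nu> c) z)) \<rho> \<and>
            2 / 3 * sqrt ((\<nu> + k) / c) < \<rho> \<and>
            \<rho> < 6 * sqrt ((\<nu> + k) * (\<nu> + 2 * k) / (c * (56 * \<nu> + 137 * k)))) \<and>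
         (\<exists>\<rho>::real. radius_of_convexity (k_Bessel_h k \<nu> c) = ereal \<rho> \<and>
            smallest_positive_root (deriv (\<lambda>z. z * deriv (k_Bessel_h k \<nu> c) z)) \<rho> \<and>
            (\<nu> + k) / c < \<rho> \<and>
            \<rho> < 16 * (\<nu> + k) * (\<nu> + 2 * k) / (c * (7 * \<nu> + 23 * k)))"
proof -
  define m where "m = \<nu> / k + 1"
  define a where "a = c / (4 * k)"
  have m: "m > 0" using assms by (simp add: m_def add_pos_pos)
  have a: "a > 0" using assms by (simp add: a_def)
  have nu: "\<nu> = (m - 1) * k" using assms(1) by (simp add: m_def)
  have c: "c = 4 * k * a" using assms(1) by (simp add: a_def)
  show ?thesis
  proof (intro conjI)
    obtain \<xi> where \<xi>: "m / 9 < \<xi>" "\<xi> < 9 * m * (m + 1) / (56 * m + 81)"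
      "eval_fps (Bessel_fps 2 m 2) \<xi> = 0"
      "\<And>x. 0 \<le> x \<Longrightarrow> x < \<xi> \<Longrightarrow> eval_fps (Bessel_fps 2 m 2) x > (0 :: real)"
    proof (rule eval_Bessel_2_first_zero[of m "m / 9" "9 * m * (m + 1) / (56 * m + 81)" 2])
      show "eval_fps (Bessel_fps 2 m 2) x > (0 :: real)" if "0 \<le> x" "x \<le> m / 9" for x
        using that m by (intro eval_Bessel_2_pos) auto
    qed (use m eval_Bessel_2_neg_quadratic in \<open>auto simp: divide_simps\<close>)
    define \<rho> where "\<rho> = sqrt (\<xi> / a)"
    have "\<xi> > 0" using \<xi>(1) m by (auto intro: order.strict_trans[rotated])
    hence \<rho>: "\<rho> > 0" "a * \<rho> ^ 2 = \<xi>" using a by (simp_all add: \<rho>_def)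
    have g: "k_Bessel_g k \<nu> c z = z * eval_fps (Bessel_fps 2 m 0) (of_real a * z ^ 2)" for z
      unfolding m_def a_def by (rule k_Bessel_g_eq[OF assms(1,3)])
    note convexity = radius_of_convexity_Bessel[OF m _ a \<rho>(1) g, unfolded \<rho>(2), OF _ \<xi>(3,4)]
    \<comment> \<open>since \<open>\<xi> = a \<rho>^2\<close>, the bounds on \<open>\<rho>\<close> are the square roots of those on \<open>\<xi> / a\<close>\<close>
    have "2 / 3 * sqrt ((\<nu> + k) / c) = sqrt ((2 / 3)\<^sup>2 * ((\<nu> + k) / c))"
      by (simp only: real_sqrt_mult real_sqrt_abs)
    also have "(2 / 3)\<^sup>2 * ((\<nu> + k) / c) = (m / 9) / a"
      unfolding nu c using assms(1) a by (simp add: field_simps power2_eq_square)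
    also have "sqrt \<dots> < \<rho>"
      unfolding \<rho>_def using \<xi>(1) a by (intro real_sqrt_less_mono divide_strict_right_mono)
    finally have lower: "2 / 3 * sqrt ((\<nu> + k) / c) < \<rho>" .
    have "\<rho> < sqrt (9 * m * (m + 1) / (56 * m + 81) / a)"
      unfolding \<rho>_def using \<xi>(2) a by (intro real_sqrt_less_mono divide_strict_right_mono)
    also have "9 * m * (m + 1) / (56 * m + 81) / a
                 = 6\<^sup>2 * ((\<nu> + k) * (\<nu> + 2 * k) / (c * (56 * \<nu> + 137 * k)))"
    proof -
      have "56 * \<nu> + 137 * k = k * (56 * m + 81)" "\<nu> + k = k * m" "\<nu> + 2 * k = k * (m + 1)"
        by (simp_all add: nu algebra_simps)
      thus ?thesis unfolding c using assms(1) a m by (simp add: divide_simps)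
    qed
    also have "sqrt \<dots> = 6 * sqrt ((\<nu> + k) * (\<nu> + 2 * k) / (c * (56 * \<nu> + 137 * k)))"
      by (simp only: real_sqrt_mult real_sqrt_abs abs_numeral)
    finally have upper: "\<rho> < 6 * sqrt ((\<nu> + k) * (\<nu> + 2 * k) / (c * (56 * \<nu> + 137 * k)))" .
    show "\<exists>\<rho>::real. radius_of_convexity (k_Bessel_g k \<nu> c) = ereal \<rho> \<and>
            smallest_positive_root (deriv (\<lambda>z. z * deriv (k_Bessel_g k \<nu> c) z)) \<rho> \<and>
            2 / 3 * sqrt ((\<nu> + k) / c) < \<rho> \<and>
            \<rho> < 6 * sqrt ((\<nu> + k) * (\<nu> + 2 * k) / (c * (56 * \<nu> + 137 * k)))"
      using convexity lower upper by (intro exI[of _ \<rho>]) simp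
  next
    obtain \<xi> where \<xi>: "m / 4 < \<xi>" "\<xi> < 4 * m * (m + 1) / (7 * m + 16)"
      "eval_fps (Bessel_fps 1 m 2) \<xi> = 0"
      "\<And>x. 0 \<le> x \<Longrightarrow> x < \<xi> \<Longrightarrow> eval_fps (Bessel_fps 1 m 2) x > (0 :: real)"
    proof (rule eval_Bessel_2_first_zero[of m "m / 4" "4 * m * (m + 1) / (7 * m + 16)" 1])
      show "eval_fps (Bessel_fps 1 m 2) x > (0 :: real)" if "0 \<le> x" "x \<le> m / 4" for x
        using that m by (intro eval_Bessel_2_pos) auto
    qed (use m eval_Bessel_2_neg_linear in \<open>auto simp: divide_simps\<close>)
    define \<rho> where "\<rho> = \<xi> / a"
    have "\<xi> > 0" using \<xi>(1) m by (auto intro: order.strict_trans[rotated])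
    hence \<rho>: "\<rho> > 0" "a * \<rho> ^ 1 = \<xi>" using a by (simp_all add: \<rho>_def)
    have h: "k_Bessel_h k \<nu> c z = z * eval_fps (Bessel_fps 1 m 0) (of_real a * z ^ 1)" for z
      unfolding m_def a_def by (rule k_Bessel_h_eq[OF assms(1,3)])
    note convexity = radius_of_convexity_Bessel[OF m _ a \<rho>(1) h, unfolded \<rho>(2), OF _ \<xi>(3,4)]
    have "(\<nu> + k) / c = (m / 4) / a"
      unfolding nu c using assms(1) a by (simp add: field_simps)
    also have "\<dots> < \<rho>"
      unfolding \<rho>_def using \<xi>(1) a by (intro divide_strict_right_mono)
    finally have lower: "(\<nu> + k) / c < \<rho>" .
    have "\<rho> < 4 * m * (m + 1) / (7 * m + 16) / a"
      unfolding \<rho>_def using \<xi>(2) a by (intro divide_strict_right_mono)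
    also have "\<dots> = 16 * (\<nu> + k) * (\<nu> + 2 * k) / (c * (7 * \<nu> + 23 * k))"
    proof -
      have "7 * \<nu> + 23 * k = k * (7 * m + 16)" "\<nu> + k = k * m" "\<nu> + 2 * k = k * (m + 1)"
        by (simp_all add: nu algebra_simps)
      thus ?thesis unfolding c using assms(1) a m by (simp add: divide_simps)
    qed
    finally have upper: "\<rho> < 16 * (\<nu> + k) * (\<nu> + 2 * k) / (c * (7 * \<nu> + 23 * k))" .
    show "\<exists>\<rho>::real. radius_of_convexity (k_Bessel_h k \<nu> c) = ereal \<rho> \<and>
            smallest_positive_root (deriv (\<lambda>z. z * deriv (k_Bessel_h k \<nu> c) z)) \<rho> \<and>
            (\<nu> + k) / c < \<rho> \<and> \<rho> < 16 * (\<nu> + k) * (\<nu> + 2 * k) / (c * (7 * \<nu> + 23 * k))"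
      using convexity lower upper by (intro exI[of _ \<rho>]) simp
  qed
qed

end
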